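(* Let $q$ be a prime power and $1\le\ell\le m$ integers. The nonzero weights of $\hat C_{\det}(1;\ell,m)$ are $\hat w_1,\dots,\hat w_\ell$, given by $$\hat w_r=w_H(\hat c_{\tau_r})=q^{\ell+m-2}+q^{\ell+m-3}+\cdots+q^{\ell+m-r-1}=q^{\ell+m-r-1}\frac{q^r-1}{q-1}$$ for $r=1,\dots,\ell$, where $\tau_r=X_{11}+\cdots+X_{rr}$. In particular $\hat w_1<\hat w_2<\cdots<\hat w_\ell$ and the minimum distance of $\hat C_{\det}(1;\ell,m)$ is $q^{\ell+m-2}$.
   Context: $\mathbb{F}_q$ is the finite field with $q$ elements; $X=(X_{ij})$ is an $\ell\times m$ matrix of indeterminates; $\mathbb{F}_q[X]_1$ is the space of linear homogeneous polynomials $f=\sum f_{ij}X_{ij}$ (with $0$), evaluated at a matrix $M$ by $f(M)=\sum f_{ij}M_{ij}$. Let $\hat M_1,\dots,\hat M_{\hat n}$ be representatives, one from each class of nonzero scalar multiples, of the matrices in $M_{\ell\times m}(\mathbb{F}_q)$ of rank exactly $1$; $\hat c_f=(f(\hat M_1),\dots,f(\hat M_{\hat n}))$ and $\hat C_{\det}(1;\ell,m)=\{\hat c_f:f\in\mathbb{F}_q[X]_1\}\subseteq\mathbb{F}_q^{\hat n}$. $w_H$ denotes Hamming weight. *)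

theory Defs
  imports "Jordan_Normal_Form.DL_Rank" "HOL-Library.Poly_Mapping"
begin

text \<open>Polynomials over \<open>'a\<close> in the indeterminates \<open>X\<^sub>i\<^sub>j\<close>: finitely supported maps from monomials
  (exponent vectors) to coefficients. Indices are 0-based, as for the matrices of
  \<open>Jordan_Normal_Form\<close>.\<close>

type_synonym 'a matrix_poly = "((nat \<times> nat) \<Rightarrow>\<^sub>0 nat) \<Rightarrow>\<^sub>0 'a"

definition X_monom :: "nat \<Rightarrow> nat \<Rightarrow> (nat \<times> nat) \<Rightarrow>\<^sub>0 nat" where
  "X_monom i j = Poly_Mapping.single (i, j) 1"

definition X_var :: "nat \<Rightarrow> nat \<Rightarrow> 'a::field matrix_poly" where
  "X_var i j = Poly_Mapping.single (X_monom i j) 1"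

definition linear_forms :: "nat \<Rightarrow> nat \<Rightarrow> 'a::field matrix_poly set" where
  "linear_forms l m = {f. Poly_Mapping.keys f \<subseteq> {X_monom i j | i j. i < l \<and> j < m}}"

text \<open>Only meant for linear forms \<open>f\<close> in the entries of \<open>M\<close>; all other coefficients are ignored.\<close>

definition eval_form :: "'a::field matrix_poly \<Rightarrow> 'a mat \<Rightarrow> 'a" where
  "eval_form f M =
     (\<Sum>i<dim_row M. \<Sum>j<dim_col M. Poly_Mapping.lookup f (X_monom i j) * M $$ (i, j))"

definition tau :: "nat \<Rightarrow> 'a::field matrix_poly" where
  "tau r = (\<Sum>i<r. X_var i i)"

definition rank_one_mats :: "nat \<Rightarrow> nat \<Rightarrow> 'a::field mat set" where
  "rank_one_mats l m = {M \<in> carrier_mat l m. vec_space.rank l M = 1}"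

definition proj_reps :: "nat \<Rightarrow> nat \<Rightarrow> 'a::field mat list \<Rightarrow> bool" where
  "proj_reps l m Ms \<longleftrightarrow> set Ms \<subseteq> rank_one_mats l m \<and>
     (\<forall>M\<in>rank_one_mats l m. \<exists>!k. k < length Ms \<and> (\<exists>c. c \<noteq> 0 \<and> M = c \<cdot>\<^sub>m Ms ! k))"

definition codeword :: "'a::field mat list \<Rightarrow> 'a matrix_poly \<Rightarrow> 'a vec" where
  "codeword Ms f = vec (length Ms) (\<lambda>k. eval_form f (Ms ! k))"

definition det_code :: "nat \<Rightarrow> nat \<Rightarrow> 'a::field mat list \<Rightarrow> 'a vec set" where
  "det_code l m Ms = codeword Ms ` linear_forms l m"

definition hamming_weight :: "'a::zero vec \<Rightarrow> nat" where
  "hamming_weight v = card {k. k < dim_vec v \<and> v $ k \<noteq> 0}"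

definition nonzero_weights :: "'a::zero vec set \<Rightarrow> nat set" where
  "nonzero_weights C = hamming_weight ` C - {0}"

text \<open>The distance is only meant for vectors of equal dimension.\<close>

definition hamming_dist :: "'a vec \<Rightarrow> 'a vec \<Rightarrow> nat" where
  "hamming_dist u v = card {k. k < dim_vec u \<and> u $ k \<noteq> v $ k}"

definition min_distance :: "'a vec set \<Rightarrow> nat" where
  "min_distance C = Inf {hamming_dist u v | u v. u \<in> C \<and> v \<in> C \<and> u \<noteq> v}"

end

theory Submission
  imports Defs "HOL-Library.Cardinality"
begin

text \<open>A rank-one matrix is an outer product \<open>u v\<^sup>T\<close> of nonzero vectors, unique up to rescaling \<open>u\<close> and \<open>v\<close>,
  and a linear form with coefficient matrix \<open>B\<close> takes the value \<open>(B\<^sup>T u) \<bullet> v\<close> on it. Hence \<open>(q - 1)\<^sup>2\<close> times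
  the weight of the codeword is the number of pairs \<open>(u, v)\<close> with \<open>(B\<^sup>T u) \<bullet> v \<noteq> 0\<close>, that is
  \<open>(q\<^sup>l - |ker B\<^sup>T|) (q - 1) q\<^bsup>m-1\<^esup>\<close>. The kernel is a subspace, so it has \<open>q\<^bsup>l-r\<^esup>\<close> elements for some
  \<open>r \<le> l\<close>; only this \<open>r\<close> matters for the weight, and \<open>\<tau>\<^sub>r\<close> realises each value of it.\<close>

section \<open>Counting in coordinate spaces over a finite field\<close>

lemma finite_carrier_vec: "finite (carrier_vec n :: 'a::finite vec set)"
proof (rule finite_subset)
  show "(carrier_vec n :: 'a vec set) \<subseteq> vec n ` ({..<n} \<rightarrow>\<^sub>E UNIV)"
  proof
    fix v :: "'a vec" assume "v \<in> carrier_vec n"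
    then have v: "vec n (restrict (\<lambda>i. v $ i) {..<n}) = v" by (intro eq_vecI) auto
    have "vec n (restrict (\<lambda>i. v $ i) {..<n}) \<in> vec n ` ({..<n} \<rightarrow>\<^sub>E UNIV)"
      by (intro imageI PiE_I) auto
    then show "v \<in> vec n ` ({..<n} \<rightarrow>\<^sub>E UNIV)" unfolding v .
  qed
qed (intro finite_imageI finite_PiE; simp)

text \<open>Closure conditions on a bare set of vectors: below, subspaces are only counted, so no
  basis or dimension is carried along.\<close>

definition vec_subspace :: "nat \<Rightarrow> 'a::field vec set \<Rightarrow> bool" where
  "vec_subspace n W \<longleftrightarrow> W \<subseteq> carrier_vec n \<and> 0\<^sub>v n \<in> W \<and>
     (\<forall>u\<in>W. \<forall>v\<in>W. u + v \<in> W) \<and> (\<forall>c. \<forall>u\<in>W. c \<cdot>\<^sub>v u \<in> W)"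

lemma vec_subspace_carrier: "vec_subspace n (carrier_vec n)"
  by (auto simp: vec_subspace_def)

text \<open>The line through \<open>w0\<close> is a complement of the kernel of
  \<open>y \<bullet> _\<close> in \<open>W\<close>: each element of \<open>W\<close> is uniquely a
  kernel element plus a scalar multiple of \<open>w0\<close>, and there are q scalars.\<close>

lemma card_functional_kernel:
  fixes W :: "'a::{field, finite} vec set"
  assumes W: "vec_subspace n W" and y: "y \<in> carrier_vec n"
    and w0: "w0 \<in> W" "y \<bullet> w0 \<noteq> 0"
  shows "card W = CARD('a) * card {w \<in> W. y \<bullet> w = 0}"
proof -
  let ?K = "{w \<in> W. y \<bullet> w = 0}"
  have cl: "w \<in> carrier_vec n" if "w \<in> W" for w
    using that W by (auto simp: vec_subspace_def)
  have add: "u + v \<in> W" if "u \<in> W" "v \<in> W" for u v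
    using that W by (auto simp: vec_subspace_def)
  have smult: "c \<cdot>\<^sub>v u \<in> W" if "u \<in> W" for c u
    using that W by (auto simp: vec_subspace_def)
  have val: "y \<bullet> (w + c \<cdot>\<^sub>v w0) = y \<bullet> w + c * (y \<bullet> w0)" if "w \<in> W" for c w
    using cl[OF that] cl[OF w0(1)] y by (simp add: scalar_prod_add_distrib[of _ n])
  have "bij_betw (\<lambda>(c, w). w + c \<cdot>\<^sub>v w0) (UNIV \<times> ?K) W"
    unfolding bij_betw_def
  proof
    show "inj_on (\<lambda>(c, w). w + c \<cdot>\<^sub>v w0) (UNIV \<times> ?K)"
    proof (rule inj_onI, clarify)
      fix c d u v
      assume K: "u \<in> W" "y \<bullet> u = 0" "v \<in> W" "y \<bullet> v = 0" and eq: "u + c \<cdot>\<^sub>v w0 = v + d \<cdot>\<^sub>v w0"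
      \<comment> \<open>The functional vanishes on \<open>?K\<close>, so its value on the sum
        recovers the scalar.\<close>
      then have "c * (y \<bullet> w0) = d * (y \<bullet> w0)" using val by (metis add_0)
      then have cd: "c = d" using w0 by simp
      moreover have "u = v"
      proof (rule eq_vecI)
        fix i assume "i < dim_vec v"
        then have i: "i < n" using cl[OF K(3)] by simp
        have "(u + c \<cdot>\<^sub>v w0) $ i = (v + d \<cdot>\<^sub>v w0) $ i" using eq by simp
        then show "u $ i = v $ i" using i cd cl[OF K(1)] cl[OF K(3)] cl[OF w0(1)] by simp
      qed (use cl[OF K(1)] cl[OF K(3)] in simp)
      ultimately show "c = d \<and> u = v" ..
    qed
    show "(\<lambda>(c, w). w + c \<cdot>\<^sub>v w0) ` (UNIV \<times> ?K) = W"
    proof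
      show "(\<lambda>(c, w). w + c \<cdot>\<^sub>v w0) ` (UNIV \<times> ?K) \<subseteq> W"
        using add smult w0 by auto
      show "W \<subseteq> (\<lambda>(c, w). w + c \<cdot>\<^sub>v w0) ` (UNIV \<times> ?K)"
      proof
        fix w assume w: "w \<in> W"
        \<comment> \<open>This is the multiple of \<open>w0\<close> whose removal from
          \<open>w\<close> makes the functional vanish.\<close>
        define c where "c = (y \<bullet> w) / (y \<bullet> w0)"
        have "w + (- c) \<cdot>\<^sub>v w0 \<in> ?K"
          using w w0 add smult val[OF w, of "- c"] by (auto simp: c_def)
        moreover have "w = (w + (- c) \<cdot>\<^sub>v w0) + c \<cdot>\<^sub>v w0"
          using cl[OF w] cl[OF w0(1)] by (intro eq_vecI) auto
        ultimately show "w \<in> (\<lambda>(c, w). w + c \<cdot>\<^sub>v w0) ` (UNIV \<times> ?K)"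
          by (intro image_eqI[of _ _ "(c, w + (- c) \<cdot>\<^sub>v w0)"]) auto
      qed
    qed
  qed
  then have "card (UNIV \<times> ?K :: ('a \<times> 'a vec) set) = card W" by (rule bij_betw_same_card)
  then show ?thesis by (simp add: card_cartesian_product)
qed

section \<open>Filtration of a subspace by initial zero coordinates\<close>

lemma vec_subspace_initial_zeros:
  assumes "vec_subspace n W" and "k \<le> n"
  shows "vec_subspace n {w \<in> W. \<forall>i<k. w $ i = 0}"
proof -
  have W: "W \<subseteq> carrier_vec n" "0\<^sub>v n \<in> W" "\<And>u v. u \<in> W \<Longrightarrow> v \<in> W \<Longrightarrow> u + v \<in> W"
    "\<And>c u. u \<in> W \<Longrightarrow> c \<cdot>\<^sub>v u \<in> W"
    using assms(1) by (auto simp: vec_subspace_def)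
  have i: "i < dim_vec w" if "w \<in> W" "i < k" for w i using W(1) that assms(2) by auto
  show ?thesis unfolding vec_subspace_def
  proof (intro conjI ballI allI)
    fix u v assume "u \<in> {w \<in> W. \<forall>i<k. w $ i = 0}" "v \<in> {w \<in> W. \<forall>i<k. w $ i = 0}"
    then show "u + v \<in> {w \<in> W. \<forall>i<k. w $ i = 0}" using W(3) i by simp
  next
    fix c u assume "u \<in> {w \<in> W. \<forall>i<k. w $ i = 0}"
    then show "c \<cdot>\<^sub>v u \<in> {w \<in> W. \<forall>i<k. w $ i = 0}" using W(4) i by simp
  qed (use W(1,2) assms(2) in auto)
qed

text \<open>Coordinate \<open>k\<close> is the functional given by \<open>unit_vec n k\<close>, and
  \<open>w0\<close> shows that it is not zero on the vectors with \<open>k\<close> initial zeros, so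
  its kernel is smaller by a factor of exactly q.\<close>

lemma card_initial_zeros_step:
  fixes W :: "'a::{field, finite} vec set"
  assumes W: "vec_subspace n W" and k: "k < n"
    and w0: "w0 \<in> W" "\<forall>i<k. w0 $ i = 0" "w0 $ k \<noteq> 0"
  shows "card {w \<in> W. \<forall>i<k. w $ i = 0} = CARD('a) * card {w \<in> W. \<forall>i<Suc k. w $ i = 0}"
proof -
  have cl: "w \<in> carrier_vec n" if "w \<in> W" for w
    using that W by (auto simp: vec_subspace_def)
  have "card {w \<in> W. \<forall>i<k. w $ i = 0}
      = CARD('a) * card {w \<in> {w \<in> W. \<forall>i<k. w $ i = 0}. unit_vec n k \<bullet> w = 0}"
    by (rule card_functional_kernel[OF vec_subspace_initial_zeros[OF W], of _ _ w0])
      (use k w0 cl[OF w0(1)] in \<open>auto simp: scalar_prod_left_unit\<close>)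
  also have "{w \<in> {w \<in> W. \<forall>i<k. w $ i = 0}. unit_vec n k \<bullet> w = 0} = {w \<in> W. \<forall>i<Suc k. w $ i = 0}"
    using k cl by (auto simp: less_Suc_eq scalar_prod_left_unit)
  finally show ?thesis .
qed

lemma vec_all_zeros:
  assumes "vec_subspace n W"
  shows "{w \<in> W. \<forall>i<n. w $ i = 0} = {0\<^sub>v n}"
proof -
  have "w = 0\<^sub>v n" if "w \<in> W" "\<forall>i<n. w $ i = 0" for w
    using that assms by (intro eq_vecI) (auto simp: vec_subspace_def)
  moreover have "0\<^sub>v n \<in> W" "\<forall>i<n. 0\<^sub>v n $ i = 0" using assms by (simp_all add: vec_subspace_def)
  ultimately show ?thesis by blast
qed

text \<open>Imposing the conditions \<open>w $ 0 = 0\<close>, \<open>w $ 1 = 0\<close>, ... one at a time divides the cardinality by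
  \<open>1\<close> or by \<open>q\<close> at each step.\<close>

lemma card_vec_subspace:
  fixes W :: "'a::{field, finite} vec set"
  assumes W: "vec_subspace n W"
  shows "\<exists>d\<le>n. card W = CARD('a) ^ d"
proof -
  \<comment> \<open>The induction lifts the conditions again, last coordinate first:
    \<open>j = 0\<close> leaves only the zero vector, \<open>j = n\<close> gives all of
    \<open>W\<close>.\<close>
  have "\<exists>d\<le>j. card {w \<in> W. \<forall>i<n-j. w $ i = 0} = CARD('a) ^ d" if "j \<le> n" for j
    using that
  proof (induction j)
    case 0
    then show ?case by (simp add: vec_all_zeros[OF W])
  next
    case (Suc j)
    then obtain d where d: "d \<le> j" "card {w \<in> W. \<forall>i<n-j. w $ i = 0} = CARD('a) ^ d" by auto
    have eq: "n - j = Suc (n - Suc j)" using Suc by simp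
    \<comment> \<open>Either coordinate \<open>n - Suc j\<close> takes a nonzero value on the larger
      set, and the exponent grows by one, or it vanishes there and both sets coincide.\<close>
    show ?case
    proof (cases "\<exists>w0\<in>W. (\<forall>i<n - Suc j. w0 $ i = 0) \<and> w0 $ (n - Suc j) \<noteq> 0")
      case True
      then obtain w0 where "w0 \<in> W" "\<forall>i<n - Suc j. w0 $ i = 0" "w0 $ (n - Suc j) \<noteq> 0" by blast
      from card_initial_zeros_step[OF W _ this] Suc d(2) eq
      have "card {w \<in> W. \<forall>i<n - Suc j. w $ i = 0} = CARD('a) ^ Suc d" by auto
      then show ?thesis using d(1) by (intro exI[of _ "Suc d"]) auto
    next
      case False
      then have "{w \<in> W. \<forall>i<n - Suc j. w $ i = 0} = {w \<in> W. \<forall>i<n-j. w $ i = 0}"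
        unfolding eq by (auto simp: less_Suc_eq)
      then show ?thesis using d by (intro exI[of _ d]) auto
    qed
  qed
  from this[of n] show ?thesis by simp
qed

text \<open>Downward induction from \<open>r = n\<close>, where only the zero vector remains. In the
  full space \<open>unit_vec n r\<close> is always a witness for the next coordinate, so every step
  contributes a factor q.\<close>

lemma card_initial_zeros:
  assumes "r \<le> n"
  shows "card {w \<in> carrier_vec n :: 'a::{field, finite} vec set. \<forall>i<r. w $ i = 0} = CARD('a) ^ (n - r)"
  using assms
proof (induction rule: inc_induct)
  case base
  show ?case by (simp only: vec_all_zeros[OF vec_subspace_carrier]) simp
next
  case (step r)
  have "card {w \<in> carrier_vec n :: 'a vec set. \<forall>i<r. w $ i = 0}
      = CARD('a) * card {w \<in> carrier_vec n :: 'a vec set. \<forall>i<Suc r. w $ i = 0}"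
    by (rule card_initial_zeros_step[OF vec_subspace_carrier, of _ _ "unit_vec n r"])
      (use step in auto)
  then show ?case using step by (simp add: Suc_diff_Suc flip: power_Suc)
qed

lemma card_carrier_vec: "card (carrier_vec n :: 'a::{field, finite} vec set) = CARD('a) ^ n"
  using card_initial_zeros[of 0 n, where 'a = 'a] by simp

lemma vec_nonzero_index:
  assumes "v \<in> carrier_vec n" "v \<noteq> 0\<^sub>v n"
  obtains i where "i < n" "v $ i \<noteq> 0"
  using assms by (metis carrier_vecD eq_vecI index_zero_vec)

text \<open>A nonzero \<open>y\<close> has a kernel of \<open>q^(n-1)\<close> vectors, and the
  complement has \<open>q^n - q^(n-1)\<close>.\<close>

lemma card_nonorthogonal:
  fixes y :: "'a::{field, finite} vec"
  assumes y: "y \<in> carrier_vec n" "y \<noteq> 0\<^sub>v n"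
  shows "card {v \<in> carrier_vec n. y \<bullet> v \<noteq> 0} = (CARD('a) - 1) * CARD('a) ^ (n - 1)"
proof -
  let ?K = "{v \<in> carrier_vec n. y \<bullet> v = 0}"
  obtain i where i: "i < n" "y $ i \<noteq> 0" using vec_nonzero_index[OF y] .
  have "card (carrier_vec n :: 'a vec set) = CARD('a) * card ?K"
    by (rule card_functional_kernel[OF vec_subspace_carrier, of _ _ "unit_vec n i"])
      (use y i in \<open>auto simp: scalar_prod_right_unit\<close>)
  \<comment> \<open>The index \<open>i < n\<close> makes \<open>n\<close> positive, so
    \<open>n - 1\<close> is not truncated.\<close>
  moreover have "CARD('a) ^ n = CARD('a) * CARD('a) ^ (n - 1)" using i by (cases n) auto
  ultimately have K: "card ?K = CARD('a) ^ (n - 1)" by (simp add: card_carrier_vec)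
  have "{v \<in> carrier_vec n. y \<bullet> v \<noteq> 0} = carrier_vec n - ?K" by auto
  then have "card {v \<in> carrier_vec n. y \<bullet> v \<noteq> 0} = card (carrier_vec n :: 'a vec set) - card ?K"
    by (metis (no_types, lifting) card_Diff_subset finite_carrier_vec finite_subset mem_Collect_eq subsetI)
  also have "\<dots> = CARD('a) * CARD('a) ^ (n - 1) - CARD('a) ^ (n - 1)"
    using K \<open>CARD('a) ^ n = _\<close> by (simp add: card_carrier_vec)
  finally show ?thesis by (simp add: diff_mult_distrib)
qed

section \<open>Rank-one matrices\<close>

definition outer_prod :: "'a::field vec \<Rightarrow> 'a vec \<Rightarrow> 'a mat" where
  "outer_prod u v = mat (dim_vec u) (dim_vec v) (\<lambda>(i, j). u $ i * v $ j)"

lemma outer_prod_carrier [simp]: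
  "u \<in> carrier_vec l \<Longrightarrow> v \<in> carrier_vec m \<Longrightarrow> outer_prod u v \<in> carrier_mat l m"
  by (simp add: outer_prod_def)

lemma outer_prod_smult:
  "outer_prod (a \<cdot>\<^sub>v u) (b \<cdot>\<^sub>v v) = (a * b) \<cdot>\<^sub>m outer_prod u v"
  by (auto simp: outer_prod_def)

text \<open>In a column \<open>j\<close> with \<open>v $ j\<close> nonzero, the entrywise equations
  can be divided by \<open>v $ j\<close>, which makes \<open>u\<close> proportional to
  \<open>u'\<close>; a row with \<open>u $ i\<close> nonzero does the same for \<open>v\<close>.
  Both factors are nonzero because \<open>u\<close> and \<open>v\<close> are.\<close>

lemma outer_prod_eqD:
  assumes u: "u \<in> carrier_vec l" "u \<noteq> 0\<^sub>v l" "u' \<in> carrier_vec l"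
    and v: "v \<in> carrier_vec m" "v \<noteq> 0\<^sub>v m" "v' \<in> carrier_vec m"
    and eq: "outer_prod u v = c \<cdot>\<^sub>m outer_prod u' v'"
  shows "\<exists>a b. a \<noteq> 0 \<and> b \<noteq> 0 \<and> u = a \<cdot>\<^sub>v u' \<and> v = b \<cdot>\<^sub>v v'"
proof -
  have entry: "u $ i * v $ j = c * (u' $ i * v' $ j)" if "i < l" "j < m" for i j
  proof -
    have "outer_prod u v $$ (i, j) = (c \<cdot>\<^sub>m outer_prod u' v') $$ (i, j)" using eq by simp
    then show ?thesis using that u v by (simp add: outer_prod_def)
  qed
  obtain i where i: "i < l" "u $ i \<noteq> 0" using vec_nonzero_index[OF u(1,2)] .
  obtain j where j: "j < m" "v $ j \<noteq> 0" using vec_nonzero_index[OF v(1,2)] .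
  define a where "a = c * v' $ j / v $ j"
  define b where "b = c * u' $ i / u $ i"
  have ua: "u = a \<cdot>\<^sub>v u'"
    using u entry[OF _ j(1)] j by (intro eq_vecI) (auto simp: a_def field_simps)
  have vb: "v = b \<cdot>\<^sub>v v'"
    using v entry[OF i(1)] i by (intro eq_vecI) (auto simp: b_def field_simps)
  have "u $ i = a * u' $ i" "v $ j = b * v' $ j"
    using ua vb i j u v by (metis carrier_vecD index_smult_vec(1))+
  then have "a \<noteq> 0" "b \<noteq> 0" using i j by auto
  then show ?thesis using ua vb by blast
qed

lemma (in vec_space) lin_indpt_singleton:
  assumes "x \<in> carrier_vec n" "x \<noteq> 0\<^sub>v n"
  shows "lin_indpt {x}"
proof -
  have "lin_indpt {}" using lin_dep_def by simp
  then show ?thesis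
    using lin_dep_iff_in_span[of "{}" x] assms span_empty by auto
qed

text \<open>Product entries bound the rank above by 1; for the lower bound, a column at a nonzero
  coordinate of \<open>v\<close> is a nonzero multiple of \<open>u\<close> and hence
  independent.\<close>

lemma (in vec_space) rank_outer_prod:
  assumes u: "u \<in> carrier_vec n" "u \<noteq> 0\<^sub>v n" and v: "v \<in> carrier_vec m" "v \<noteq> 0\<^sub>v m"
  shows "rank (outer_prod u v) = 1"
proof (rule antisym)
  show "rank (outer_prod u v) \<le> 1"
    by (rule rank_le_1_product_entries[of _ m "\<lambda>i. u $ i" "\<lambda>j. v $ j"])
      (use u v in \<open>auto simp: outer_prod_def\<close>)
  obtain i where i: "i < n" "u $ i \<noteq> 0" using vec_nonzero_index[OF u] .
  obtain j where j: "j < m" "v $ j \<noteq> 0" using vec_nonzero_index[OF v] .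
  let ?x = "col (outer_prod u v) j"
  have x: "?x \<in> carrier_vec n" using u by (intro carrier_vecI) (simp add: outer_prod_def)
  have "?x $ i \<noteq> 0" using i j u v by (simp add: outer_prod_def)
  then have "lin_indpt {?x}" using i x by (intro lin_indpt_singleton) auto
  moreover have "{?x} \<subseteq> set (cols (outer_prod u v))"
    using j v by (auto simp: cols_def outer_prod_def)
  ultimately have "card {?x} \<le> rank (outer_prod u v)"
    by (intro rank_ge_card_indpt[of _ m]) (use u v in auto)
  then show "1 \<le> rank (outer_prod u v)" by simp
qed

text \<open>A maximal independent set of columns has a single element \<open>u\<close>. By
  maximality every column is a multiple of \<open>u\<close>, and the multipliers are the coordinates
  of \<open>v\<close>.\<close>

lemma (in vec_space) rank_one_outer_prod:
  assumes A: "A \<in> carrier_mat n m" and r: "rank A = 1"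
  obtains u v where "u \<in> carrier_vec n" "u \<noteq> 0\<^sub>v n" "v \<in> carrier_vec m" "v \<noteq> 0\<^sub>v m"
    "A = outer_prod u v"
proof -
  have cl: "x \<in> carrier_vec n" if "x \<in> set (cols A)" for x
    using that cols_dim A by blast
  have "lin_indpt {}" using lin_dep_def by simp
  then obtain U where U: "maximal U (\<lambda>T. T \<subseteq> set (cols A) \<and> lin_indpt T)"
    using maximal_exists_superset[of "set (cols A)" "\<lambda>T. T \<subseteq> set (cols A) \<and> lin_indpt T" "{}"]
    by auto
  then have "card U = 1" using rank_card_indpt[OF A U] r by simp
  then obtain u where Uu: "U = {u}" by (auto simp: card_1_singleton_iff)
  have uA: "u \<in> set (cols A)" and ui: "lin_indpt {u}" using U Uu by (auto simp: maximal_def)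
  have u: "u \<in> carrier_vec n" using cl uA .
  \<comment> \<open>Nontriviality of the scalars is what makes a set containing the zero vector
    dependent, hence \<open>u\<close> nonzero.\<close>
  have "(UNIV :: 'a set) \<noteq> {0}" by (metis UNIV_I singletonD zero_neq_one)
  then have u0: "u \<noteq> 0\<^sub>v n" using ui zero_lin_dep[of "{u}"] by auto
  have "\<exists>c. x = c \<cdot>\<^sub>v u" if x: "x \<in> set (cols A)" for x
  proof (cases "x = u")
    case True
    then show ?thesis by (intro exI[of _ 1]) simp
  next
    case False
    have "lin_dep ({u} \<union> {x})"
    proof (rule ccontr)
      assume "\<not> lin_dep ({u} \<union> {x})"
      moreover have "T = {u}" if "{u} \<subseteq> T" "T \<subseteq> set (cols A)" "lin_indpt T" for T
        using U that unfolding Uu maximal_def by simp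
      from this[of "{u} \<union> {x}"] have "lin_indpt ({u} \<union> {x}) \<Longrightarrow> {u} \<union> {x} = {u}"
        using x uA by simp
      ultimately have "{u} \<union> {x} = {u}" by simp
      then show False using False by auto
    qed
    then have "x \<in> span {u}" using lin_dep_iff_in_span[of "{u}" x] u ui cl[OF x] False by auto
    then obtain a T where "x = lincomb a T" "T \<subseteq> {u}" using in_spanE by blast
    \<comment> \<open>\<open>T\<close> may be empty; then \<open>x\<close> is zero, which is still a
      multiple of \<open>u\<close>.\<close>
    then have "x = 0\<^sub>v n \<or> x = a u \<cdot>\<^sub>v u"
      using u by (auto simp: subset_singleton_iff lincomb_def)
    moreover have "0\<^sub>v n = 0 \<cdot>\<^sub>v u" using u by auto
    ultimately show ?thesis by metis
  qed
  then have "\<forall>j<m. \<exists>c. col A j = c \<cdot>\<^sub>v u" using A by (auto simp: cols_def)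
  then obtain c where c: "\<And>j. j < m \<Longrightarrow> col A j = c j \<cdot>\<^sub>v u" by metis
  have Aeq: "A = outer_prod u (vec m c)"
  proof (rule eq_matI)
    fix i j assume "i < dim_row (outer_prod u (vec m c))" "j < dim_col (outer_prod u (vec m c))"
    then have ij: "i < n" "j < m" using u by (auto simp: outer_prod_def)
    have "A $$ (i, j) = col A j $ i" using ij A by simp
    also have "\<dots> = c j * u $ i" using c[OF ij(2)] ij u by simp
    finally show "A $$ (i, j) = outer_prod u (vec m c) $$ (i, j)"
      using ij u by (simp add: outer_prod_def)
  qed (use A u in \<open>auto simp: outer_prod_def\<close>)
  \<comment> \<open>Since \<open>u\<close> is itself a column, its own multiplier cannot be zero, so
    the second factor is not the zero vector.\<close>
  obtain j where j: "j < m" "u = col A j" using uA A by (auto simp: cols_def)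
  have "c j \<noteq> 0"
  proof
    assume "c j = 0"
    then have "u = 0 \<cdot>\<^sub>v u" using c[OF j(1)] j by simp
    also have "\<dots> = 0\<^sub>v n" using u by auto
    finally show False using u0 by simp
  qed
  then have "vec m c \<noteq> 0\<^sub>v m" using j(1) by (metis index_vec index_zero_vec(1))
  then show thesis using that[of u "vec m c"] u u0 Aeq by simp
qed

lemma outer_prod_in_rank_one_mats:
  assumes "u \<in> carrier_vec l" "u \<noteq> 0\<^sub>v l" "v \<in> carrier_vec m" "v \<noteq> 0\<^sub>v m"
  shows "outer_prod u v \<in> rank_one_mats l m"
  using assms vec_space.rank_outer_prod[OF assms] by (simp add: rank_one_mats_def)

section \<open>Weights of codewords\<close>

definition coeff_mat :: "nat \<Rightarrow> nat \<Rightarrow> 'a::field matrix_poly \<Rightarrow> 'a mat" where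
  "coeff_mat l m f = mat l m (\<lambda>(i, j). Poly_Mapping.lookup f (X_monom i j))"

text \<open>After exchanging the sums, the inner sum over \<open>i\<close> is coordinate
  \<open>j\<close> of the transposed coefficient matrix applied to \<open>u\<close>, times
  \<open>v $ j\<close>.\<close>

lemma eval_form_outer_prod:
  assumes "u \<in> carrier_vec l" "v \<in> carrier_vec m"
  shows "eval_form f (outer_prod u v) = (transpose_mat (coeff_mat l m f) *\<^sub>v u) \<bullet> v"
proof -
  have "eval_form f (outer_prod u v)
      = (\<Sum>i<l. \<Sum>j<m. Poly_Mapping.lookup f (X_monom i j) * (u $ i * v $ j))"
    using assms by (simp add: eval_form_def outer_prod_def)
  also have "\<dots> = (\<Sum>j<m. \<Sum>i<l. Poly_Mapping.lookup f (X_monom i j) * (u $ i * v $ j))"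
    by (rule sum.swap)
  also have "\<dots> = (transpose_mat (coeff_mat l m f) *\<^sub>v u) \<bullet> v"
    using assms
    by (auto simp: coeff_mat_def scalar_prod_def sum_distrib_right mult.assoc atLeast0LessThan
        intro!: sum.cong)
  finally show ?thesis .
qed

lemma eval_form_smult: "eval_form f (c \<cdot>\<^sub>m M) = c * eval_form f M"
  by (auto simp: eval_form_def sum_distrib_left algebra_simps intro!: sum.cong)

lemma eval_form_diff: "eval_form (f - g) M = eval_form f M - eval_form g M"
  by (simp add: eval_form_def lookup_minus algebra_simps sum_subtractf)

lemma hamming_weight_codeword:
  "hamming_weight (codeword Ms f) = card {k. k < length Ms \<and> eval_form f (Ms ! k) \<noteq> 0}"
  unfolding hamming_weight_def codeword_def by (rule arg_cong[of _ _ card]) auto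

text \<open>Each projective class of rank-one matrices is hit by exactly \<open>(q - 1)\<^sup>2\<close> pairs \<open>(u, v)\<close>, namely
  the independent rescalings of the two factors of its representative.\<close>

lemma weight_eq_card_pairs:
  fixes Ms :: "'a::{field, finite} mat list"
  assumes reps: "proj_reps l m Ms"
  shows "(CARD('a) - 1)\<^sup>2 * hamming_weight (codeword Ms f)
    = card {(u, v). u \<in> carrier_vec l \<and> v \<in> carrier_vec m \<and> eval_form f (outer_prod u v) \<noteq> 0}"
    (is "_ = card ?P")
proof -
  define S where "S = {k. k < length Ms \<and> eval_form f (Ms ! k) \<noteq> 0}"
  have "\<exists>u v. u \<in> carrier_vec l \<and> u \<noteq> 0\<^sub>v l \<and> v \<in> carrier_vec m \<and> v \<noteq> 0\<^sub>v m \<and> Ms ! k = outer_prod u v"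
    if "k < length Ms" for k
  proof -
    have "Ms ! k \<in> rank_one_mats l m" using reps that by (auto simp: proj_reps_def)
    then have "Ms ! k \<in> carrier_mat l m" "vec_space.rank l (Ms ! k) = 1"
      by (simp_all add: rank_one_mats_def)
    then show ?thesis by (rule vec_space.rank_one_outer_prod) blast
  qed
  then obtain U V where U: "\<And>k. k < length Ms \<Longrightarrow> U k \<in> carrier_vec l"
      "\<And>k. k < length Ms \<Longrightarrow> U k \<noteq> 0\<^sub>v l"
    and V: "\<And>k. k < length Ms \<Longrightarrow> V k \<in> carrier_vec m" "\<And>k. k < length Ms \<Longrightarrow> V k \<noteq> 0\<^sub>v m"
    and UV: "\<And>k. k < length Ms \<Longrightarrow> Ms ! k = outer_prod (U k) (V k)"
    by metis
  \<comment> \<open>A triple is a position of nonzero value together with the scalars that rescale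
    the two chosen factors of its representative.\<close>
  define g where "g = (\<lambda>(k, a, b). (a \<cdot>\<^sub>v U k, b \<cdot>\<^sub>v V k))"
  let ?N = "UNIV - {0::'a}"
  have scale_inj: "a = b" if eq: "a \<cdot>\<^sub>v x = b \<cdot>\<^sub>v x" and x: "x \<in> carrier_vec n" "x \<noteq> 0\<^sub>v n"
    for a b :: 'a and x n
  proof -
    obtain i where i: "i < n" "x $ i \<noteq> 0" using vec_nonzero_index[OF x] .
    have "(a \<cdot>\<^sub>v x) $ i = (b \<cdot>\<^sub>v x) $ i" using eq by simp
    then show ?thesis using i x by simp
  qed
  have "bij_betw g (S \<times> ?N \<times> ?N) ?P"
    unfolding bij_betw_def
  proof
    show "inj_on g (S \<times> ?N \<times> ?N)"
    proof (rule inj_onI)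
      fix x y assume x: "x \<in> S \<times> ?N \<times> ?N" and y: "y \<in> S \<times> ?N \<times> ?N" and gxy: "g x = g y"
      obtain k a b k' a' b' where xy: "x = (k, a, b)" "y = (k', a', b')" by (metis prod_cases3)
      have S: "k \<in> S" "k' \<in> S" and nz: "a \<noteq> 0" "b \<noteq> 0" "a' \<noteq> 0" "b' \<noteq> 0"
        using x y xy by auto
      have eq: "g (k, a, b) = g (k', a', b')" using gxy xy by simp
      have k: "k < length Ms" "k' < length Ms" using S by (auto simp: S_def)
      have e: "a \<cdot>\<^sub>v U k = a' \<cdot>\<^sub>v U k'" "b \<cdot>\<^sub>v V k = b' \<cdot>\<^sub>v V k'" using eq by (auto simp: g_def)
      \<comment> \<open>Multiplying the two equalities makes the representatives at \<open>k\<close>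
        and \<open>k'\<close> proportional; uniqueness in \<open>proj_reps\<close> will force
        \<open>k = k'\<close>, after which the scalars can be compared.\<close>
      then have "(a * b) \<cdot>\<^sub>m Ms ! k = (a' * b') \<cdot>\<^sub>m Ms ! k'"
        using k by (simp add: UV flip: outer_prod_smult)
      then have "inverse (a * b) \<cdot>\<^sub>m ((a * b) \<cdot>\<^sub>m Ms ! k) = inverse (a * b) \<cdot>\<^sub>m ((a' * b') \<cdot>\<^sub>m Ms ! k')"
        by simp
      moreover have "c \<cdot>\<^sub>m (d \<cdot>\<^sub>m A) = (c * d) \<cdot>\<^sub>m A" "1 \<cdot>\<^sub>m A = A" for c d and A :: "'a mat"
        by (auto simp: mult.assoc)
      ultimately have Mk: "Ms ! k = (inverse (a * b) * (a' * b')) \<cdot>\<^sub>m Ms ! k'"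
        using nz by (simp del: inverse_mult_distrib)
      have "Ms ! k \<in> rank_one_mats l m" using reps k by (auto simp: proj_reps_def)
      then have ex1: "\<exists>!j. j < length Ms \<and> (\<exists>c. c \<noteq> 0 \<and> Ms ! k = c \<cdot>\<^sub>m Ms ! j)"
        using reps by (auto simp: proj_reps_def)
      have "Ms ! k = 1 \<cdot>\<^sub>m Ms ! k" by auto
      then have P1: "k < length Ms \<and> (\<exists>c. c \<noteq> 0 \<and> Ms ! k = c \<cdot>\<^sub>m Ms ! k)"
        using k by (metis zero_neq_one)
      have "inverse (a * b) * (a' * b') \<noteq> 0" using nz by simp
      then have P2: "k' < length Ms \<and> (\<exists>c. c \<noteq> 0 \<and> Ms ! k = c \<cdot>\<^sub>m Ms ! k')"
        using k Mk by blast
      have kk: "k = k'" using ex1 P1 P2 by blast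
      then show "x = y"
        using xy e scale_inj[OF _ U] scale_inj[OF _ V] k by auto
    qed
    show "g ` (S \<times> ?N \<times> ?N) = ?P"
    proof
      show "g ` (S \<times> ?N \<times> ?N) \<subseteq> ?P"
        using U V by (auto simp: g_def S_def outer_prod_smult eval_form_smult simp flip: UV)
      show "?P \<subseteq> g ` (S \<times> ?N \<times> ?N)"
      proof clarify
        fix u v
        assume uv: "u \<in> carrier_vec l" "v \<in> carrier_vec m" and ev: "eval_form f (outer_prod u v) \<noteq> 0"
        \<comment> \<open>A zero factor gives the zero matrix, on which every form vanishes; so
          \<open>?P\<close> contains only pairs of nonzero vectors.\<close>
        have u0: "u \<noteq> 0\<^sub>v l" using ev uv by (auto simp: eval_form_def outer_prod_def)
        have v0: "v \<noteq> 0\<^sub>v m" using ev uv by (auto simp: eval_form_def outer_prod_def)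
        have "outer_prod u v \<in> rank_one_mats l m" using uv u0 v0 by (intro outer_prod_in_rank_one_mats)
        then obtain k c where k: "k < length Ms" and c: "outer_prod u v = c \<cdot>\<^sub>m Ms ! k"
          using reps unfolding proj_reps_def by blast
        have "outer_prod u v = c \<cdot>\<^sub>m outer_prod (U k) (V k)" using c UV[OF k] by simp
        then obtain a b where ab: "a \<noteq> 0" "b \<noteq> 0" "u = a \<cdot>\<^sub>v U k" "v = b \<cdot>\<^sub>v V k"
          using outer_prod_eqD[OF uv(1) u0 U(1)[OF k] uv(2) v0 V(1)[OF k]] by blast
        have "k \<in> S" using ev k c by (auto simp: S_def eval_form_smult)
        then show "(u, v) \<in> g ` (S \<times> ?N \<times> ?N)"
          using ab by (intro image_eqI[of _ _ "(k, a, b)"]) (auto simp: g_def)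
      qed
    qed
  qed
  then have "card ?P = card (S \<times> ?N \<times> ?N)" by (rule bij_betw_same_card[symmetric])
  also have "\<dots> = (CARD('a) - 1)\<^sup>2 * card S"
    by (simp add: card_cartesian_product card_Diff_singleton power2_eq_square)
  finally show ?thesis by (simp add: hamming_weight_codeword S_def)
qed

section \<open>From the size of the kernel to the weight\<close>

lemma card_field_ge_2: "2 \<le> CARD('a::{field, finite})"
proof -
  have "card {0, 1 :: 'a} \<le> CARD('a)" by (rule card_mono) auto
  then show ?thesis by simp
qed

text \<open>Fibre the pairs over \<open>u\<close>: a \<open>u\<close> in the kernel admits no
  \<open>v\<close>, and any other \<open>u\<close> admits as many as
  \<open>card_nonorthogonal\<close> counts.\<close>

lemma card_pairs:
  fixes B :: "'a::{field, finite} mat"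
  assumes B: "B \<in> carrier_mat m l"
  shows "card {(u, v). u \<in> carrier_vec l \<and> v \<in> carrier_vec m \<and> (B *\<^sub>v u) \<bullet> v \<noteq> 0}
    = (CARD('a) ^ l - card {u \<in> carrier_vec l. B *\<^sub>v u = 0\<^sub>v m}) * ((CARD('a) - 1) * CARD('a) ^ (m - 1))"
proof -
  let ?K = "{u \<in> carrier_vec l. B *\<^sub>v u = 0\<^sub>v m}"
  have "{(u, v). u \<in> carrier_vec l \<and> v \<in> carrier_vec m \<and> (B *\<^sub>v u) \<bullet> v \<noteq> 0}
      = (SIGMA u : carrier_vec l - ?K. {v \<in> carrier_vec m. (B *\<^sub>v u) \<bullet> v \<noteq> 0})"
    by auto
  moreover have "card \<dots> = (\<Sum>u\<in>carrier_vec l - ?K. (CARD('a) - 1) * CARD('a) ^ (m - 1))"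
    by (subst card_SigmaI)
      (use B in \<open>auto simp: finite_carrier_vec card_nonorthogonal intro!: sum.cong\<close>)
  moreover have "card (carrier_vec l - ?K) = CARD('a) ^ l - card ?K"
    by (subst card_Diff_subset)
      (auto simp: card_carrier_vec intro: finite_subset[OF _ finite_carrier_vec[of l]])
  ultimately show ?thesis by simp
qed

text \<open>The sum telescopes after multiplication by \<open>q - 1\<close>. It is stated over the
  reals to keep the differences of powers exact; \<open>r \<le> l\<close> and
  \<open>1 \<le> m\<close> keep the exponents untruncated.\<close>

lemma geometric_weight_sum:
  assumes "r \<le> l" "1 \<le> m"
  shows "(real q - 1) * (\<Sum>k=1..r. real q ^ (l + m - k - 1)) = real q ^ (m - 1) * (real q ^ l - real q ^ (l - r))"
  using assms(1)
proof (induction r)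
  case 0
  then show ?case by simp
next
  case (Suc r)
  have e1: "l - r = Suc (l - Suc r)" using Suc.prems by simp
  have "l + m - Suc (Suc r) = (m - Suc 0) + (l - Suc r)" using Suc.prems assms(2) by simp
  then have e2: "real q ^ (l + m - Suc (Suc r)) = real q ^ (m - Suc 0) * real q ^ (l - Suc r)"
    by (simp only: power_add)
  show ?case using Suc by (simp add: e1 e2 algebra_simps)
qed

text \<open>The form enters the pair count only through the size of its kernel. Comparing the two
  counts of pairs and cancelling \<open>(q - 1)^2\<close> leaves the geometric sum.\<close>

lemma weight_from_kernel:
  fixes Ms :: "'a::{field, finite} mat list"
  assumes reps: "proj_reps l m Ms" and m: "1 \<le> m" and r: "r \<le> l"
    and ker: "card {u \<in> carrier_vec l. transpose_mat (coeff_mat l m f) *\<^sub>v u = 0\<^sub>v m} = CARD('a) ^ (l - r)"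
  shows "hamming_weight (codeword Ms f) = (\<Sum>k=1..r. CARD('a) ^ (l + m - k - 1))"
proof -
  let ?q = "CARD('a)" and ?w = "hamming_weight (codeword Ms f)"
  let ?B = "transpose_mat (coeff_mat l m f)"
  have B: "?B \<in> carrier_mat m l" by (simp add: coeff_mat_def)
  have q: "2 \<le> ?q" by (rule card_field_ge_2)
  have "{(u, v). u \<in> carrier_vec l \<and> v \<in> carrier_vec m \<and> eval_form f (outer_prod u v) \<noteq> 0}
      = {(u, v). u \<in> carrier_vec l \<and> v \<in> carrier_vec m \<and> (?B *\<^sub>v u) \<bullet> v \<noteq> 0}"
    by (auto simp: eval_form_outer_prod)
  then have "(?q - 1)\<^sup>2 * ?w = (?q ^ l - ?q ^ (l - r)) * ((?q - 1) * ?q ^ (m - 1))"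
    using weight_eq_card_pairs[OF reps, of f] card_pairs[OF B] ker by simp
  then have "real ((?q - 1)\<^sup>2 * ?w) = real ((?q ^ l - ?q ^ (l - r)) * ((?q - 1) * ?q ^ (m - 1)))"
    by (simp only:)
  \<comment> \<open>This inequality allows the natural-number difference to be cast to the
    reals.\<close>
  moreover have "?q ^ (l - r) \<le> ?q ^ l" using q by (intro power_increasing) auto
  then have "real ((?q ^ l - ?q ^ (l - r)) * ((?q - 1) * ?q ^ (m - 1)))
      = (real ?q ^ l - real ?q ^ (l - r)) * ((real ?q - 1) * real ?q ^ (m - 1))"
    using q by (simp add: of_nat_diff)
  moreover have "real ((?q - 1)\<^sup>2 * ?w) = (real ?q - 1)\<^sup>2 * real ?w"
    using q by (simp add: of_nat_diff)
  ultimately have "(real ?q - 1)\<^sup>2 * real ?w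
      = (real ?q ^ l - real ?q ^ (l - r)) * ((real ?q - 1) * real ?q ^ (m - 1))"
    by (simp only:)
  then have "(real ?q - 1) * ((real ?q - 1) * real ?w)
      = (real ?q - 1) * (real ?q ^ (m - 1) * (real ?q ^ l - real ?q ^ (l - r)))"
    by (simp only: power2_eq_square ac_simps)
  then have "(real ?q - 1) * real ?w = (real ?q - 1) * (\<Sum>k=1..r. real ?q ^ (l + m - k - 1))"
    unfolding geometric_weight_sum[OF r m] using q by simp
  then have "real ?w = real (\<Sum>k=1..r. ?q ^ (l + m - k - 1))" using q by simp
  then show ?thesis by (simp only: of_nat_eq_iff)
qed

lemma vec_subspace_kernel:
  assumes B: "B \<in> carrier_mat m l"
  shows "vec_subspace l {u \<in> carrier_vec l. B *\<^sub>v u = 0\<^sub>v m}"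
  using B
  by (auto simp: vec_subspace_def mult_add_distrib_mat_vec[OF B] mult_mat_vec[OF B])

text \<open>The kernel has \<open>q^d\<close> elements with \<open>d \<le> l\<close>, and
  \<open>r = l - d\<close> is the rank of the coefficient matrix, obtained by counting.\<close>

lemma ex_weight:
  fixes Ms :: "'a::{field, finite} mat list"
  assumes "proj_reps l m Ms" "1 \<le> m"
  shows "\<exists>r\<le>l. hamming_weight (codeword Ms f) = (\<Sum>k=1..r. CARD('a) ^ (l + m - k - 1))"
proof -
  have "transpose_mat (coeff_mat l m f) \<in> carrier_mat m l" by (simp add: coeff_mat_def)
  from card_vec_subspace[OF vec_subspace_kernel[OF this]]
  obtain d where d: "d \<le> l"
    "card {u \<in> carrier_vec l. transpose_mat (coeff_mat l m f) *\<^sub>v u = 0\<^sub>v m} = CARD('a) ^ d" by auto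
  then have "hamming_weight (codeword Ms f) = (\<Sum>k=1..l-d. CARD('a) ^ (l + m - k - 1))"
    by (intro weight_from_kernel assms) auto
  then show ?thesis by (intro exI[of _ "l - d"]) auto
qed

section \<open>The forms \<open>tau r\<close> as witnesses for each weight\<close>

lemma lookup_tau: "Poly_Mapping.lookup (tau r) (X_monom i j) = (if i = j \<and> i < r then 1 else 0)"
proof -
  \<comment> \<open>Distinct index pairs give distinct monomials, so the terms of
    \<open>tau r\<close> never merge.\<close>
  have "X_monom a a = X_monom i j \<longleftrightarrow> a = i \<and> a = j" for a
    unfolding X_monom_def by (metis lookup_single_eq lookup_single_not_eq prod.inject zero_neq_one)
  then have "Poly_Mapping.lookup (tau r :: 'a matrix_poly) (X_monom i j)
      = (\<Sum>a<r. if a = i \<and> a = j then 1 else 0)"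
    by (simp add: tau_def X_var_def lookup_sum lookup_single when_def)
  also have "\<dots> = (if i = j \<and> i < r then 1 else 0)" by (cases "i = j") auto
  finally show ?thesis .
qed

lemma tau_in_linear_forms:
  assumes "r \<le> l" "r \<le> m"
  shows "tau r \<in> linear_forms l m"
proof -
  have "Poly_Mapping.keys (tau r :: 'a matrix_poly)
      \<subseteq> (\<Union>i<r. Poly_Mapping.keys (X_var i i :: 'a matrix_poly))"
    unfolding tau_def by (rule keys_sum)
  also have "\<dots> \<subseteq> {X_monom i j | i j. i < l \<and> j < m}"
    using assms by (fastforce simp: X_var_def)
  finally show ?thesis by (simp add: linear_forms_def)
qed

text \<open>The transposed coefficient matrix of \<open>tau r\<close> keeps the first
  \<open>r\<close> coordinates and sends the others to zero, so its kernel consists of the vectors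
  with \<open>r\<close> initial zeros.\<close>

lemma weight_tau:
  fixes Ms :: "'a::{field, finite} mat list"
  assumes "proj_reps l m Ms" "1 \<le> m" "l \<le> m" "r \<le> l"
  shows "hamming_weight (codeword Ms (tau r)) = (\<Sum>k=1..r. CARD('a) ^ (l + m - k - 1))"
proof (rule weight_from_kernel)
  let ?B = "transpose_mat (coeff_mat l m (tau r :: 'a matrix_poly))"
  have idx: "(?B *\<^sub>v u) $ j = (if j < r then u $ j else 0)" if u: "u \<in> carrier_vec l" and j: "j < m" for u j
  proof -
    have "(?B *\<^sub>v u) $ j = (\<Sum>i<l. (if i = j \<and> i < r then 1 else 0) * u $ i)"
      using u j by (auto simp: coeff_mat_def scalar_prod_def lookup_tau atLeast0LessThan intro!: sum.cong)
    also have "\<dots> = (\<Sum>i<l. if i = j then (if j < r then u $ j else 0) else 0)"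
      by (intro sum.cong) auto
    finally show ?thesis using \<open>r \<le> l\<close> by simp
  qed
  have "?B *\<^sub>v u = 0\<^sub>v m \<longleftrightarrow> (\<forall>i<r. u $ i = 0)" if u: "u \<in> carrier_vec l" for u
  proof
    assume z: "?B *\<^sub>v u = 0\<^sub>v m"
    show "\<forall>i<r. u $ i = 0"
    proof (intro allI impI)
      fix i assume "i < r"
      then show "u $ i = 0" using idx[OF u, of i] z assms by simp
    qed
  next
    assume "\<forall>i<r. u $ i = 0"
    then show "?B *\<^sub>v u = 0\<^sub>v m"
      using idx[OF u] by (intro eq_vecI) (simp_all add: coeff_mat_def del: index_mult_mat_vec)
  qed
  then have "{u \<in> carrier_vec l. ?B *\<^sub>v u = 0\<^sub>v m} = {u \<in> carrier_vec l. \<forall>i<r. u $ i = 0}" by auto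
  then show "card {u \<in> carrier_vec l. ?B *\<^sub>v u = 0\<^sub>v m} = CARD('a) ^ (l - r)"
    using card_initial_zeros[OF \<open>r \<le> l\<close>, where 'a = 'a] by simp
qed (use assms in auto)

section \<open>Distances between codewords as weights\<close>

lemma linear_forms_diff:
  assumes "f \<in> linear_forms l m" "g \<in> linear_forms l m"
  shows "f - g \<in> linear_forms l m"
  using assms keys_diff[of f g] unfolding linear_forms_def by blast

lemma zero_in_linear_forms: "0 \<in> linear_forms l m"
  by (simp add: linear_forms_def)

lemma hamming_dist_codewords:
  "hamming_dist (codeword Ms f) (codeword Ms g) = hamming_weight (codeword Ms (f - g))"
proof -
  have "{k. k < length Ms \<and> codeword Ms f $ k \<noteq> codeword Ms g $ k}
      = {k. k < length Ms \<and> eval_form (f - g) (Ms ! k) \<noteq> 0}"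
    by (auto simp: codeword_def eval_form_diff)
  then show ?thesis by (simp add: hamming_dist_def hamming_weight_codeword) (simp add: codeword_def)
qed

text \<open>\<open>hamming_dist\<close> inspects only indices of its first argument; all codewords
  have length \<open>length Ms\<close>, so agreement there is equality.\<close>

lemma codeword_dist_zero_iff:
  fixes Ms :: "'a::field mat list"
  shows "hamming_dist (codeword Ms f) (codeword Ms g) = 0 \<longleftrightarrow> codeword Ms f = codeword Ms g"
proof -
  have "dim_vec (codeword Ms h) = length Ms" for h :: "'a matrix_poly" by (simp add: codeword_def)
  then show ?thesis by (auto simp: hamming_dist_def intro!: eq_vecI)
qed

text \<open>The code is closed under differences and contains the zero word, so a distance is the
  weight of a difference and a weight is a distance to the zero word.\<close>

lemma dists_eq_nonzero_weights:
  "{hamming_dist u v | u v. u \<in> det_code l m Ms \<and> v \<in> det_code l m Ms \<and> u \<noteq> v}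
    = nonzero_weights (det_code l m Ms)" (is "?D = ?W")
proof
  show "?D \<subseteq> ?W"
  proof
    fix d assume "d \<in> ?D"
    then obtain f g where fg: "f \<in> linear_forms l m" "g \<in> linear_forms l m"
        "codeword Ms f \<noteq> codeword Ms g" "d = hamming_dist (codeword Ms f) (codeword Ms g)"
      unfolding det_code_def by auto
    then have "d \<noteq> 0" by (simp add: codeword_dist_zero_iff)
    then show "d \<in> ?W" using fg linear_forms_diff[OF fg(1,2)]
      by (auto simp: nonzero_weights_def det_code_def hamming_dist_codewords)
  qed
  show "?W \<subseteq> ?D"
  proof
    fix d assume "d \<in> ?W"
    then obtain f where f: "f \<in> linear_forms l m" "d = hamming_weight (codeword Ms f)" "d \<noteq> 0"
      by (auto simp: nonzero_weights_def det_code_def)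
    then have d: "d = hamming_dist (codeword Ms f) (codeword Ms 0)" by (simp add: hamming_dist_codewords)
    then have "codeword Ms f \<noteq> codeword Ms 0" using f(3) codeword_dist_zero_iff by metis
    then show "d \<in> ?D" using d f(1) zero_in_linear_forms unfolding det_code_def by blast
  qed
qed

section \<open>The weight spectrum and the minimum distance\<close>

theorem theorem4p2:
  fixes l m q :: nat
    and Ms :: "'a::{field, finite} mat list"
  assumes "card (UNIV :: 'a set) = q"
    and "1 \<le> l" and "l \<le> m"
    and "proj_reps l m Ms"
  shows "nonzero_weights (det_code l m Ms)
           = (\<lambda>r. hamming_weight (codeword Ms (tau r))) ` {1..l} \<and>
         (\<forall>r\<in>{1..l}.
           hamming_weight (codeword Ms (tau r)) = (\<Sum>k=1..r. q ^ (l + m - k - 1)) \<and>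
           real (hamming_weight (codeword Ms (tau r)))
             = real q ^ (l + m - r - 1) * ((real q ^ r - 1) / (real q - 1))) \<and>
         strict_mono_on {1..l} (\<lambda>r. hamming_weight (codeword Ms (tau r))) \<and>
         min_distance (det_code l m Ms) = q ^ (l + m - 2)"
proof -
  let ?w = "\<lambda>r. hamming_weight (codeword Ms (tau r))"
  have m: "1 \<le> m" using assms by simp
  have q: "2 \<le> q" using card_field_ge_2[where 'a = 'a] assms(1) by simp
  have w: "?w r = (\<Sum>k=1..r. q ^ (l + m - k - 1))" if "r \<le> l" for r
    using weight_tau[OF assms(4) m assms(3) that] assms(1) by simp
  \<comment> \<open>The sum for \<open>s\<close> contains all terms for \<open>r\<close> and the
    positive term at index \<open>s\<close>. With \<open>r = 0\<close> this also shows that the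
    weights are nonzero.\<close>
  have mono: "?w r < ?w s" if "r < s" "s \<le> l" for r s
  proof -
    have "?w r < (\<Sum>k=1..s. q ^ (l + m - k - 1))"
      unfolding w[OF order.trans[OF less_imp_le[OF that(1)] that(2)]]
      by (rule sum_strict_mono2[of _ _ s]) (use that q in auto)
    then show ?thesis by (simp only: w[OF that(2)])
  qed
  have w0: "?w 0 = 0" using w[of 0] by simp
  have weights: "nonzero_weights (det_code l m Ms) = ?w ` {1..l}"
  proof
    show "nonzero_weights (det_code l m Ms) \<subseteq> ?w ` {1..l}"
    proof
      fix d assume "d \<in> nonzero_weights (det_code l m Ms)"
      then obtain f where f: "d = hamming_weight (codeword Ms f)" "d \<noteq> 0"
        by (auto simp: nonzero_weights_def det_code_def)
      then obtain r where r: "r \<le> l" "d = ?w r"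
        using ex_weight[OF assms(4) m, of f] assms(1) w by auto
      \<comment> \<open>The kernel argument allows \<open>r = 0\<close>, the empty sum; a nonzero
        weight excludes it.\<close>
      then have "r \<noteq> 0" using f(2) w0 by metis
      then show "d \<in> ?w ` {1..l}" using r by auto
    qed
    show "?w ` {1..l} \<subseteq> nonzero_weights (det_code l m Ms)"
    proof clarify
      fix r assume r: "r \<in> {1..l}"
      then have "?w r \<noteq> 0" using mono[of 0 r] by simp
      moreover have "tau r \<in> linear_forms l m" using r assms by (intro tau_in_linear_forms) auto
      ultimately show "?w r \<in> nonzero_weights (det_code l m Ms)"
        by (auto simp: nonzero_weights_def det_code_def)
    qed
  qed
  have closed: "real (?w r) = real q ^ (l + m - r - 1) * ((real q ^ r - 1) / (real q - 1))"
    if r: "r \<in> {1..l}" for r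
  proof -
    have "l + m - Suc r = (m - Suc 0) + (l - r)" using r m by auto
    then have e: "real q ^ (l + m - Suc r) = real q ^ (m - Suc 0) * real q ^ (l - r)"
      by (simp only: power_add)
    have "real q ^ l = real q ^ (l - r) * real q ^ r" using r by (simp flip: power_add)
    then have "(real q - 1) * real (?w r) = real q ^ (l + m - r - 1) * (real q ^ r - 1)"
      using geometric_weight_sum[of r l m q] r m w[of r] by (simp add: e algebra_simps)
    then show ?thesis using q by (simp add: field_simps)
  qed
  have "min_distance (det_code l m Ms) = Inf (?w ` {1..l})"
    unfolding min_distance_def dists_eq_nonzero_weights weights ..
  also have "\<dots> = ?w 1"
  proof (rule cInf_eq_minimum)
    show "?w 1 \<in> ?w ` {1..l}" using assms(2) by auto
    show "?w 1 \<le> x" if "x \<in> ?w ` {1..l}" for x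
    proof -
      from that obtain r where "1 \<le> r" "r \<le> l" "x = ?w r" by auto
      then show ?thesis using mono[of 1 r] by (cases "r = 1") auto
    qed
  qed
  \<comment> \<open>For \<open>r = 1\<close> the sum has the single exponent
    \<open>l + m - 1 - 1\<close>.\<close>
  also have "\<dots> = q ^ (l + m - 2)" using w[OF assms(2)] by (simp add: numeral_2_eq_2)
  finally have dist: "min_distance (det_code l m Ms) = q ^ (l + m - 2)" .
  have "strict_mono_on {1..l} ?w" using mono by (auto intro!: strict_mono_onI)
  then show ?thesis using weights closed w dist by auto
qed

end
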